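(* Let $N\ge3$, $\delta x>0$, and let $F,\kappa$ be smooth functions. For $N$-periodic sequences $\varrho=(\rho_i)_{i=1,\dots,N}$ and $\mathrm{u}=(u_i)_{i=1,\dots,N}$ (indices modulo $N$) define the discrete Hamiltonian $$\mathrm{H}(\varrho,\mathrm{u})=\sum_{i=1}^N\left(\rho_i\frac{u_i^2}{2}+F(\rho_i)+\frac12\kappa(\rho_i)\Big(\frac{\rho_{i+1}-\rho_i}{\delta x}\Big)^2\right).$$ Then every solution $(\varrho(t),\mathrm{u}(t))$ of the system of ordinary differential equations $$\frac{d}{dt}\begin{pmatrix}\varrho\\ \mathrm{u}\end{pmatrix}=J\begin{pmatrix}D\nabla_\varrho\mathrm{H}(\varrho,\mathrm{u})\\ D\nabla_{\mathrm{u}}\mathrm{H}(\varrho,\mathrm{u})\end{pmatrix}$$ is entropy conservative: $\mathrm{H}(\varrho,\mathrm{u})(t)=\mathrm{H}(\varrho,\mathrm{u})(0)$ for all times $t$ at which the solution is defined.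
   Context: This is a semi-discretization, with periodic boundary conditions, of the Euler–Korteweg system written as a Hamiltonian system in the variables $(\rho,u)$, with Hamiltonian density $\rho u^2/2+F(\rho)+\kappa(\rho)(\partial_x\rho)^2/2$. Here $$J=\begin{pmatrix}0&-\mathrm{I}_N\\-\mathrm{I}_N&0\end{pmatrix},$$ and $D$ is the centered difference operator on $N$-periodic sequences, $(D\mathrm{u})_i=\dfrac{u_{i+1}-u_{i-1}}{2\delta x}$. $\nabla_\varrho\mathrm{H}$ and $\nabla_{\mathrm{u}}\mathrm{H}$ are the gradients of $\mathrm{H}$ with respect to $\varrho\in\mathbb{R}^N$ and $\mathrm{u}\in\mathbb{R}^N$. The densities $\rho_i$ are assumed to stay in the domain of definition of $F$ and $\kappa$ (e.g. $\rho_i>0$). *)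

theory Defs
  imports
    "HOL-Analysis.Analysis"
    "Berlekamp_Zassenhaus.Finite_Field"
begin

text \<open>
  The index type \<open>'n mod_ring\<close> is the ring of integers modulo \<open>N = CARD('n)\<close>, so \<open>i + 1\<close> and
  \<open>i - 1\<close> are taken modulo \<open>N\<close>, and \<open>N\<close>-periodic sequences are the vectors indexed by it.
\<close>

type_synonym 'n periodic = "(real, 'n mod_ring) vec"

text \<open>
  For open \<open>S\<close> the values of the total functions \<open>(deriv ^^ k) f\<close> outside \<open>S\<close> are irrelevant.
\<close>

definition smooth_on :: "real set \<Rightarrow> (real \<Rightarrow> real) \<Rightarrow> bool" where
  "smooth_on S f \<longleftrightarrow> (\<forall>k. \<forall>x\<in>S. (deriv ^^ k) f field_differentiable (at x))"

definition gradient :: "('a::real_inner \<Rightarrow> real) \<Rightarrow> 'a \<Rightarrow> 'a" where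
  "gradient f x = (THE g. GDERIV f x :> g)"

definition Ham ::
    "real \<Rightarrow> (real \<Rightarrow> real) \<Rightarrow> (real \<Rightarrow> real) \<Rightarrow> 'n::nontriv periodic \<Rightarrow> 'n periodic \<Rightarrow> real" where
  "Ham dx F \<kappa> \<rho> u =
     (\<Sum>i\<in>UNIV. \<rho> $ i * ((u $ i)\<^sup>2 / 2) + F (\<rho> $ i)
        + 1 / 2 * \<kappa> (\<rho> $ i) * ((\<rho> $ (i + 1) - \<rho> $ i) / dx)\<^sup>2)"

definition Dop :: "real \<Rightarrow> 'n::nontriv periodic \<Rightarrow> 'n periodic" where
  "Dop dx v = (\<chi> i. (v $ (i + 1) - v $ (i - 1)) / (2 * dx))"

text \<open>The block matrix with rows \<open>(0, -I)\<close> and \<open>(-I, 0)\<close>, acting on pairs of vectors.\<close>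

definition J :: "'n::nontriv periodic \<times> 'n periodic \<Rightarrow> 'n periodic \<times> 'n periodic" where
  "J = (\<lambda>(a, b). (- b, - a))"

text \<open>
  \<open>T\<close> is the time interval on which the solution is defined (one-sided derivatives at endpoints
  belonging to \<open>T\<close>), and \<open>\<Omega>\<close> is the domain of \<open>F\<close> and \<open>\<kappa>\<close>, in which the densities stay.
\<close>

definition EK_solution ::
    "real \<Rightarrow> (real \<Rightarrow> real) \<Rightarrow> (real \<Rightarrow> real) \<Rightarrow> real set \<Rightarrow> real set \<Rightarrow>
     (real \<Rightarrow> 'n::nontriv periodic) \<Rightarrow> (real \<Rightarrow> 'n periodic) \<Rightarrow> bool" where
  "EK_solution dx F \<kappa> \<Omega> T \<rho> u \<longleftrightarrow>
     (\<forall>t\<in>T. (\<forall>i. \<rho> t $ i \<in> \<Omega>) \<and>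
        ((\<lambda>s. (\<rho> s, u s)) has_vector_derivative
           J (Dop dx (gradient (\<lambda>r. Ham dx F \<kappa> r (u t)) (\<rho> t)),
              Dop dx (gradient (\<lambda>v. Ham dx F \<kappa> (\<rho> t) v) (u t))))
          (at t within T))"

end

(* The derivative of H along a solution is the inner product of its gradient (A, B) with
   (- D B, - D A), which vanishes because D is skew-symmetric. *)
theory Submission
  imports Defs
begin

text \<open>Let \<open>(a, b)\<close> be the gradient of H in both variables jointly. Its components
  are the partial gradients of the system, so by the chain rule dH/dt is the inner product of
  \<open>(a, b)\<close> with \<open>J (Dop dx a, Dop dx b)\<close>, that is -(Db . a) - (Da . b).
  The centered difference on a cyclic index set is skew-symmetric (\<open>inner_Dop_skew\<close>),
  so the two terms cancel (\<open>inner_J_Dop_eq_0\<close>), and H is constant on the interval. The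
  chain rule rests on joint differentiability (\<open>differentiable_Ham\<close>).\<close>

lemma differentiable_imp_GDERIV:
  fixes f :: "'a::euclidean_space \<Rightarrow> real"
  assumes "f differentiable (at x)"
  obtains g where "GDERIV f x :> g"
proof -
  from assms obtain L where L: "(f has_derivative L) (at x)"
    by (auto simp: differentiable_def)
  then have "linear L"
    by (rule has_derivative_linear)
  \<comment> \<open>Riesz representation: the adjoint applied to 1 is the gradient.\<close>
  then have "L h = h \<bullet> adjoint L 1" for h
    using adjoint_works[of L h 1] by simp
  then have "L = (\<lambda>h. h \<bullet> adjoint L 1)"
    by auto
  with L that show thesis
    unfolding gderiv_def by metis
qed

text \<open>Makes the definite description in \<open>gradient\<close> denote; the proof tests the
  common derivative in the direction \<open>a - b\<close>.\<close>

lemma GDERIV_unique: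
  assumes "GDERIV f x :> a" and "GDERIV f x :> b"
  shows "a = b"
proof -
  have "(\<lambda>h. h \<bullet> a) = (\<lambda>h. h \<bullet> b)"
    using assms unfolding gderiv_def by (rule has_derivative_unique)
  then have "(a - b) \<bullet> a = (a - b) \<bullet> b"
    by (rule fun_cong)
  then have "(a - b) \<bullet> (a - b) = 0"
    by (simp add: inner_diff_right)
  then show ?thesis
    by simp
qed

lemma gradient_eqI:
  assumes "GDERIV f x :> g"
  shows "gradient f x = g"
  unfolding gradient_def using assms by (blast intro: GDERIV_unique)

text \<open>Freezing \<open>y\<close> composes \<open>f\<close> with an affine embedding whose
  derivative is \<open>h\<close> to \<open>(h, 0)\<close>, and this pairs with \<open>(a, b)\<close>
  to \<open>h \<bullet> a\<close>.\<close>

lemma GDERIV_Pair_fst: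
  assumes "GDERIV f (x, y) :> (a, b)"
  shows "GDERIV (\<lambda>z. f (z, y)) x :> a"
proof -
  have "((\<lambda>z. (z, y)) has_derivative (\<lambda>h. (h, 0))) (at x)"
    by (auto intro!: derivative_eq_intros)
  from has_derivative_compose[OF this assms[unfolded gderiv_def]] show ?thesis
    by (simp add: gderiv_def)
qed

lemma GDERIV_Pair_snd:
  assumes "GDERIV f (x, y) :> (a, b)"
  shows "GDERIV (\<lambda>z. f (x, z)) y :> b"
proof -
  have "((\<lambda>z. (x, z)) has_derivative (\<lambda>h. (0, h))) (at y)"
    by (auto intro!: derivative_eq_intros)
  from has_derivative_compose[OF this assms[unfolded gderiv_def]] show ?thesis
    by (simp add: gderiv_def)
qed

lemma smooth_on_imp_differentiable:
  assumes "smooth_on S f" and "x \<in> S"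
  shows "f differentiable (at x)"
proof -
  have "(deriv ^^ 0) f field_differentiable (at x)"
    using assms unfolding smooth_on_def by blast
  then show ?thesis
    by (simp add: field_differentiable_imp_differentiable)
qed

lemma differentiable_Ham:
  fixes r v :: "'n::nontriv periodic"
  assumes "\<And>i. F differentiable (at (r $ i))" and "\<And>i. \<kappa> differentiable (at (r $ i))"
  shows "(\<lambda>(r, v). Ham dx F \<kappa> r v) differentiable (at (r, v))"
proof -
  have proj: "(\<lambda>p::'n periodic \<times> 'n periodic. fst p $ i) differentiable (at q)"
    "(\<lambda>p::'n periodic \<times> 'n periodic. snd p $ i) differentiable (at q)" for i q
    by (auto intro: bounded_linear_imp_differentiable bounded_linear_compose[OF bounded_linear_vec_nth]
        bounded_linear_fst bounded_linear_snd)
  have comp: "(\<lambda>p::'n periodic \<times> 'n periodic. f (fst p $ i)) differentiable (at (r, v))"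
    if "f differentiable (at (r $ i))" for f :: "real \<Rightarrow> real" and i
    using differentiable_chain_at[OF proj(1)[of i "(r, v)"]] that by (simp add: o_def)
  show ?thesis
    \<comment> \<open>Division becomes multiplication by a constant, so the product rule applies
      with no side condition on \<open>dx\<close>.\<close>
    unfolding Ham_def case_prod_unfold divide_inverse
    by (intro differentiable_sum ballI differentiable_add differentiable_mult differentiable_power
        differentiable_diff differentiable_const proj comp assms) simp
qed

text \<open>Summation by parts: the shift permutes the cyclic index set, so no boundary terms
  arise.\<close>

lemma inner_Dop_skew: "Dop dx v \<bullet> w = - (v \<bullet> Dop dx w)"
  for v w :: "'n::nontriv periodic"
proof -
  have bij: "bij (\<lambda>i::'n mod_ring. i + 1)"
    by (rule bij_betw_byWitness[where f' = "\<lambda>i. i - 1"]) auto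
  have shift: "(\<Sum>i\<in>UNIV. a $ (i + 1) * b $ i) = (\<Sum>i\<in>UNIV. a $ i * b $ (i - 1))"
    for a b :: "'n periodic"
    using sum.reindex_bij_betw[OF bij, of "\<lambda>i. a $ i * b $ (i - 1)"] by simp
  have "Dop dx v \<bullet> w =
      ((\<Sum>i\<in>UNIV. v $ (i + 1) * w $ i) - (\<Sum>i\<in>UNIV. w $ i * v $ (i - 1))) / (2 * dx)"
    by (simp add: inner_vec_def Dop_def sum_subtractf[symmetric] sum_divide_distrib algebra_simps)
  \<comment> \<open>Reindexing moves the shift from one factor to the other, turning a forward
    neighbor into a backward one; this reverses the sign of the difference.\<close>
  also have "\<dots> =
      ((\<Sum>i\<in>UNIV. v $ i * w $ (i - 1)) - (\<Sum>i\<in>UNIV. w $ (i + 1) * v $ i)) / (2 * dx)"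
    by (simp only: shift)
  also have "\<dots> = - (v \<bullet> Dop dx w)"
    by (simp add: inner_vec_def Dop_def sum_subtractf[symmetric] sum_negf[symmetric]
        sum_divide_distrib diff_divide_distrib algebra_simps)
  finally show ?thesis .
qed

lemma inner_J_Dop_eq_0: "J (Dop dx a, Dop dx b) \<bullet> (a, b) = 0"
  using inner_Dop_skew[of dx a b] by (simp add: J_def inner_commute)

theorem mainTheorem8:
  fixes dx :: real
    and F \<kappa> :: "real \<Rightarrow> real"
    and \<Omega> T :: "real set"
    and \<rho> u :: "real \<Rightarrow> 'n::nontriv periodic"
  assumes "CARD('n) \<ge> 3"
    and "dx > 0"
    and "open \<Omega>"
    and "smooth_on \<Omega> F"
    and "smooth_on \<Omega> \<kappa>"
    and "is_interval T"
    and "0 \<in> T"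
    and "EK_solution dx F \<kappa> \<Omega> T \<rho> u"
  shows "\<forall>t\<in>T. Ham dx F \<kappa> (\<rho> t) (u t) = Ham dx F \<kappa> (\<rho> 0) (u 0)"
proof
  fix t assume "t \<in> T"
  let ?H = "\<lambda>(r, v). Ham dx F \<kappa> r v"
  have "((\<lambda>s. ?H (\<rho> s, u s)) has_derivative (\<lambda>h. 0)) (at s within T)" if "s \<in> T" for s
  proof -
    have "\<rho> s $ i \<in> \<Omega>" for i
      using assms(8) that unfolding EK_solution_def by blast
    then have "?H differentiable (at (\<rho> s, u s))"
      using assms(4,5) by (intro differentiable_Ham smooth_on_imp_differentiable)
    then obtain a b where ab: "GDERIV ?H (\<rho> s, u s) :> (a, b)"
      by (metis differentiable_imp_GDERIV surj_pair)
    have "gradient (\<lambda>r. Ham dx F \<kappa> r (u s)) (\<rho> s) = a"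
      "gradient (\<lambda>v. Ham dx F \<kappa> (\<rho> s) v) (u s) = b"
      using GDERIV_Pair_fst[OF ab] GDERIV_Pair_snd[OF ab] by (simp_all add: gradient_eqI)
    then have "((\<lambda>s. (\<rho> s, u s)) has_derivative (\<lambda>h. h *\<^sub>R J (Dop dx a, Dop dx b))) (at s within T)"
      using assms(8) that unfolding EK_solution_def has_vector_derivative_def by auto
    \<comment> \<open>H has a full derivative at the point and the curve one within
      \<open>T\<close>, so endpoints of \<open>T\<close> are covered too.\<close>
    from has_derivative_compose[OF this ab[unfolded gderiv_def]]
    show ?thesis
      by (simp only: inner_scaleR_left inner_J_Dop_eq_0 mult_zero_right)
  qed
  \<comment> \<open>A vanishing derivative forces constancy because the interval \<open>T\<close> is
    convex.\<close>
  then have "\<exists>c. \<forall>s\<in>T. ?H (\<rho> s, u s) = c"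
    by (rule has_derivative_zero_constant[OF is_interval_convex[OF assms(6)]])
  with \<open>t \<in> T\<close> assms(7) show "Ham dx F \<kappa> (\<rho> t) (u t) = Ham dx F \<kappa> (\<rho> 0) (u 0)"
    by auto
qed

end
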